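(* Let $G$ be a regular graph on $n$ vertices with $m$ edges, which is neither the complete graph $K_n$ nor the empty graph $\overline{K_n}$, and let $\lambda_1\ge\cdots\ge\lambda_n$ be its adjacency eigenvalues. Then $$\frac12\mathcal{E}(G)\ge\frac{2m-\lambda_1(\lambda_1-\lambda_2)}{\lambda_2-\lambda_n}.$$
   Context: Graphs are finite, simple, undirected. $\mathcal{E}(G)$ is the energy of $G$: the sum of the absolute values of the adjacency eigenvalues of $G$. *)

theory Defs
  imports "HOL-Library.Multiset" "Jordan_Normal_Form.Char_Poly"
begin

text \<open>A finite simple undirected graph is given by its vertex set \<open>V\<close> and its edge set
  \<open>E\<close>, a set of two-element subsets of \<open>V\<close>.\<close>

definition all_edges :: "'a set \<Rightarrow> 'a set set" where
  "all_edges V = {e. e \<subseteq> V \<and> card e = 2}"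

definition simple_graph :: "'a set \<Rightarrow> 'a set set \<Rightarrow> bool" where
  "simple_graph V E \<longleftrightarrow> finite V \<and> E \<subseteq> all_edges V"

definition vertex_degree :: "'a set set \<Rightarrow> 'a \<Rightarrow> nat" where
  "vertex_degree E v = card {e \<in> E. v \<in> e}"

definition regular_graph :: "'a set \<Rightarrow> 'a set set \<Rightarrow> bool" where
  "regular_graph V E \<longleftrightarrow> simple_graph V E \<and> (\<exists>k. \<forall>v\<in>V. vertex_degree E v = k)"

definition is_complete_graph :: "'a set \<Rightarrow> 'a set set \<Rightarrow> bool" where
  "is_complete_graph V E \<longleftrightarrow> E = all_edges V"

definition is_empty_graph :: "'a set set \<Rightarrow> bool" where
  "is_empty_graph E \<longleftrightarrow> E = {}"

text \<open>Matrices are indexed by natural numbers, so the vertices are first listed in some order.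
  Another order conjugates the adjacency matrix by a permutation matrix and leaves its
  characteristic polynomial unchanged.\<close>

definition vertex_list :: "'a set \<Rightarrow> 'a list" where
  "vertex_list V = (SOME vs. distinct vs \<and> set vs = V)"

definition adjacency_matrix :: "'a set \<Rightarrow> 'a set set \<Rightarrow> real mat" where
  "adjacency_matrix V E =
     mat (card V) (card V)
       (\<lambda>(i, j). if {vertex_list V ! i, vertex_list V ! j} \<in> E then 1 else 0)"

text \<open>Eigenvalues are counted with multiplicity. Taking only the real roots loses nothing,
  because the adjacency matrix is real symmetric: there are exactly \<open>card V\<close> of them.\<close>

definition graph_spectrum :: "'a set \<Rightarrow> 'a set set \<Rightarrow> real multiset" where
  "graph_spectrum V E = proots (char_poly (adjacency_matrix V E))"

text \<open>The \<open>i\<close>-th largest eigenvalue, for \<open>1 \<le> i \<le> card V\<close>.\<close>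

definition graph_eigenvalue :: "'a set \<Rightarrow> 'a set set \<Rightarrow> nat \<Rightarrow> real" where
  "graph_eigenvalue V E i = rev (sorted_list_of_multiset (graph_spectrum V E)) ! (i - 1)"

definition graph_energy :: "'a set \<Rightarrow> 'a set set \<Rightarrow> real" where
  "graph_energy V E = (\<Sum>x\<in>#graph_spectrum V E. \<bar>x\<bar>)"

end

theory Submission
  imports Defs "Jordan_Normal_Form.Schur_Decomposition"
begin

text \<open>The eigenvalues sum to \<open>tr A = 0\<close>, so the positive ones sum to half the energy \<open>S\<close>, and
  the negative ones to \<open>-S\<close>. Their squares sum to \<open>tr A\<^sup>2 = 2m\<close>. An eigenvalue
  \<open>x\<close> other than the largest satisfies \<open>x\<^sup>2 \<le> \<lambda>\<^sub>2 x\<close> if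
  \<open>x \<ge> 0\<close> and \<open>x\<^sup>2 \<le> \<lambda>\<^sub>n x\<close> if \<open>x < 0\<close>. Adding up,
  \<open>2m \<le> \<lambda>\<^sub>1\<^sup>2 + \<lambda>\<^sub>2 (S - \<lambda>\<^sub>1) - \<lambda>\<^sub>n S\<close>.\<close>

section \<open>Real symmetric matrices\<close>

text \<open>Rayleigh quotient: for an eigenvector \<open>v\<close>, the form \<open>q\<close> = v* A
  v equals \<open>c\<close> times \<open>s\<close> = v* v. Symmetry makes \<open>q\<close> real, and
  \<open>s\<close> is real and nonzero, so \<open>c = q / s\<close> is real.\<close>

lemma real_eigenvalue_of_symmetric:
  fixes A :: "real mat" and c :: complex
  assumes A: "A \<in> carrier_mat n n" and sym: "\<And>i j. i < n \<Longrightarrow> j < n \<Longrightarrow> A $$ (i, j) = A $$ (j, i)"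
    and ev: "eigenvalue (map_mat complex_of_real A) c"
  shows "c \<in> \<real>"
proof -
  let ?A = "map_mat complex_of_real A"
  from ev obtain v where v: "v \<in> carrier_vec n" "v \<noteq> 0\<^sub>v n" "?A *\<^sub>v v = c \<cdot>\<^sub>v v"
    using A unfolding eigenvalue_def eigenvector_def by auto
  have row: "(\<Sum>j<n. of_real (A $$ (i, j)) * v $ j) = c * v $ i" if "i < n" for i
  proof -
    have "(?A *\<^sub>v v) $ i = (c \<cdot>\<^sub>v v) $ i" by (simp only: v(3))
    thus ?thesis using that A v(1)
      by (simp add: scalar_prod_def lessThan_atLeast0 row_def cong: sum.cong_simp)
  qed
  define q where "q = (\<Sum>i<n. \<Sum>j<n. cnj (v $ i) * of_real (A $$ (i, j)) * v $ j)"
  define s where "s = (\<Sum>i<n. cnj (v $ i) * v $ i)"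
  have "q = (\<Sum>i<n. cnj (v $ i) * (\<Sum>j<n. of_real (A $$ (i, j)) * v $ j))"
    unfolding q_def by (simp add: sum_distrib_left mult.assoc)
  also have "\<dots> = (\<Sum>i<n. cnj (v $ i) * (c * v $ i))"
    by (rule sum.cong) (simp_all add: row)
  also have "\<dots> = c * s"
    unfolding s_def sum_distrib_left by (simp add: mult.left_commute)
  finally have qs: "q = c * s" .
  \<comment> \<open>Conjugation fixes the real entries and exchanges the two copies of
    \<open>v\<close>; after swapping the sums, symmetry of \<open>A\<close> restores
    \<open>q\<close>.\<close>
  have "cnj q = (\<Sum>j<n. \<Sum>i<n. v $ i * of_real (A $$ (i, j)) * cnj (v $ j))"
    unfolding q_def cnj_sum by (subst sum.swap) simp
  also have "\<dots> = q" unfolding q_def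
    by (intro sum.cong) (auto simp: sym)
  finally have cq: "cnj q = q" .
  have s: "s = of_real (\<Sum>i<n. (cmod (v $ i))\<^sup>2)"
    unfolding s_def of_real_sum
    by (rule sum.cong) (simp_all only: complex_norm_square mult.commute)
  have "s \<noteq> 0"
  proof
    assume "s = 0"
    hence "(\<Sum>i<n. (cmod (v $ i))\<^sup>2) = 0" using s by (metis of_real_eq_0_iff)
    hence "v $ i = 0" if "i < n" for i
      using that by (subst (asm) sum_nonneg_eq_0_iff) auto
    hence "v = 0\<^sub>v n" using v(1) by (intro eq_vecI) auto
    thus False using v(2) by contradiction
  qed
  hence "c = q / s" using qs by simp
  moreover have "q \<in> \<real>" using cq by (simp add: Reals_cnj_iff)
  moreover have "s \<in> \<real>" using s by simp
  ultimately show ?thesis by simp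
qed

text \<open>Over the complex numbers the polynomial splits, and all its roots are real. The
  factorization is thus the image of a real one, and the embedding of real polynomials is
  injective.\<close>

lemma char_poly_symmetric_factorized:
  fixes A :: "real mat"
  assumes A: "A \<in> carrier_mat n n" and sym: "\<And>i j. i < n \<Longrightarrow> j < n \<Longrightarrow> A $$ (i, j) = A $$ (j, i)"
  obtains es where "char_poly A = (\<Prod>e\<leftarrow>es. [:- e, 1:])"
proof -
  let ?A = "map_mat complex_of_real A"
  have A': "?A \<in> carrier_mat n n" using A by simp
  interpret mp: map_poly_inj_comm_ring_hom complex_of_real ..
  from char_poly_factorized[OF A'] obtain as
    where as: "char_poly ?A = (\<Prod>a\<leftarrow>as. [:- a, 1:])" by blast
  have real: "a \<in> \<real>" if "a \<in> set as" for a
  proof (rule real_eigenvalue_of_symmetric[OF A sym])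
    show "eigenvalue ?A a" unfolding eigenvalue_root_char_poly[OF A'] as
      using that by (simp add: poly_prod_list prod_list_zero_iff)
  qed
  have "map_poly complex_of_real (char_poly A) = (\<Prod>a\<leftarrow>as. [:- a, 1:])"
    unfolding of_real_hom.char_poly_hom[OF A, symmetric] by (rule as)
  also have "\<dots> = (\<Prod>a\<leftarrow>as. map_poly complex_of_real [:- Re a, 1:])"
    by (rule arg_cong[where f = prod_list], rule map_cong) (auto simp: real)
  also have "\<dots> = map_poly complex_of_real (\<Prod>e\<leftarrow>map Re as. [:- e, 1:])"
    by (simp add: mp.hom_prod_list o_def)
  finally show ?thesis using that[of "map Re as"] by simp
qed

section \<open>Traces of similar and of triangular matrices\<close>

definition mat_trace :: "'a :: comm_monoid_add mat \<Rightarrow> 'a" where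
  "mat_trace A = (\<Sum>i<dim_row A. A $$ (i, i))"

lemma mat_trace_eq_diag: "mat_trace A = sum_list (diag_mat A)"
  by (simp add: mat_trace_def diag_mat_def sum_list_distinct_conv_sum_set lessThan_atLeast0)

lemma mat_trace_mult:
  assumes "A \<in> carrier_mat n m" "B \<in> carrier_mat m n"
  shows "mat_trace (A * B) = (\<Sum>i<n. \<Sum>j<m. A $$ (i, j) * B $$ (j, i))"
  using assms by (simp add: mat_trace_def scalar_prod_def lessThan_atLeast0)

lemma mat_trace_comm:
  fixes A B :: "'a :: comm_semiring_0 mat"
  assumes A: "A \<in> carrier_mat n m" and B: "B \<in> carrier_mat m n"
  shows "mat_trace (A * B) = mat_trace (B * A)"
  unfolding mat_trace_mult[OF A B] mat_trace_mult[OF B A]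
  by (subst sum.swap) (simp add: mult.commute)

lemma mat_trace_similar:
  fixes A B :: "'a :: comm_ring_1 mat"
  assumes A: "A \<in> carrier_mat n n" and wit: "similar_mat_wit A B P Q"
  shows "mat_trace A = mat_trace B"
proof -
  note w = similar_mat_witD2[OF A wit]
  have "mat_trace A = mat_trace (Q * (P * B))"
    unfolding w(3) using w by (intro mat_trace_comm[of _ n n]) auto
  also have "Q * (P * B) = B"
    using w by (subst assoc_mult_mat[symmetric, of _ n n _ n _ n]) auto
  finally show ?thesis .
qed

text \<open>For \<open>i\<close> and \<open>j\<close> distinct, one of \<open>B $$ (i, j)\<close>
  and \<open>B $$ (j, i)\<close> lies below the diagonal, so only the squared diagonal entries
  survive.\<close>

lemma mat_trace_square_upper_triangular:
  fixes B :: "'a :: comm_semiring_1 mat"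
  assumes B: "B \<in> carrier_mat n n" and ut: "upper_triangular B"
  shows "mat_trace (B * B) = (\<Sum>e\<leftarrow>diag_mat B. e\<^sup>2)"
proof -
  have "(\<Sum>j<n. B $$ (i, j) * B $$ (j, i)) = (B $$ (i, i))\<^sup>2" if i: "i < n" for i
  proof -
    have "B $$ (i, j) * B $$ (j, i) = 0" if "j < n" "j \<noteq> i" for j
      using that i B upper_triangularD[OF ut, of i j] upper_triangularD[OF ut, of j i]
      by (cases "i < j") auto
    hence "(\<Sum>j<n. B $$ (i, j) * B $$ (j, i)) = (\<Sum>j\<in>{i}. B $$ (i, j) * B $$ (j, i))"
      using i by (intro sum.mono_neutral_right) auto
    thus ?thesis by (simp add: power2_eq_square)
  qed
  hence "mat_trace (B * B) = (\<Sum>i<n. (B $$ (i, i))\<^sup>2)"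
    by (simp add: mat_trace_mult[OF B B])
  thus ?thesis using B
    by (simp add: diag_mat_def o_def sum_list_distinct_conv_sum_set lessThan_atLeast0)
qed

lemma proots_prod_linear: "proots (\<Prod>e\<leftarrow>es. [:- e, 1:]) = mset (es :: 'a :: idom list)"
proof (induction es)
  case (Cons e es)
  have "(\<Prod>e\<leftarrow>es. [:- e, 1:]) \<noteq> 0" by (auto simp: prod_list_zero_iff)
  thus ?case by (simp add: proots_mult Cons.IH del: mult_pCons_left)
qed simp

text \<open>Schur decomposition gives an upper triangular \<open>B\<close>, similar to
  \<open>A\<close>, with the roots \<open>es\<close> on its diagonal. The size and both power sums
  can be read off \<open>B\<close>, since similarity preserves traces.\<close>

theorem symmetric_spectrum:
  fixes A :: "real mat"
  assumes A: "A \<in> carrier_mat n n" and sym: "\<And>i j. i < n \<Longrightarrow> j < n \<Longrightarrow> A $$ (i, j) = A $$ (j, i)"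
  shows "size (proots (char_poly A)) = n"
    and "(\<Sum>x\<in>#proots (char_poly A). x) = mat_trace A"
    and "(\<Sum>x\<in>#proots (char_poly A). x\<^sup>2) = mat_trace (A * A)"
proof -
  obtain es where es: "char_poly A = (\<Prod>e\<leftarrow>es. [:- e, 1:])"
    by (rule char_poly_symmetric_factorized[OF A sym])
  obtain B P Q where "schur_decomposition A es = (B, P, Q)" by (metis prod_cases3)
  from schur_decomposition[OF A es this] have wit: "similar_mat_wit A B P Q"
    and ut: "upper_triangular B" and diag: "diag_mat B = es" by auto
  note w = similar_mat_witD2[OF A wit]
  have roots: "proots (char_poly A) = mset es" by (simp add: es proots_prod_linear)
  show "size (proots (char_poly A)) = n"
    using w(5) by (simp add: roots flip: diag) (simp add: diag_mat_def)
  show "(\<Sum>x\<in>#proots (char_poly A). x) = mat_trace A"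
    by (simp add: roots mat_trace_similar[OF A wit] mat_trace_eq_diag[of B] diag sum_mset_sum_list)
  \<comment> \<open>The same \<open>P\<close> and \<open>Q\<close> conjugate the squares, so the
    trace of \<open>A * A\<close> can be computed on the triangular side.\<close>
  have "similar_mat_wit (A * A) (B * B) P Q"
    using similar_mat_wit_pow[OF wit, of 2] A w(5)
    by (simp add: numeral_2_eq_2)
  hence "mat_trace (A * A) = mat_trace (B * B)"
    using A by (intro mat_trace_similar[of _ n]) auto
  also have "\<dots> = (\<Sum>e\<leftarrow>es. e\<^sup>2)"
    using mat_trace_square_upper_triangular[OF w(5) ut] diag by simp
  finally show "(\<Sum>x\<in>#proots (char_poly A). x\<^sup>2) = mat_trace (A * A)"
    by (simp add: roots flip: mset_map sum_mset_sum_list)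
qed

section \<open>The adjacency matrix\<close>

lemma vertex_list:
  assumes "finite V"
  shows "distinct (vertex_list V)" "set (vertex_list V) = V" "length (vertex_list V) = card V"
proof -
  have "\<exists>vs. distinct vs \<and> set vs = V" using finite_distinct_list[OF assms] by blast
  hence "distinct (vertex_list V) \<and> set (vertex_list V) = V"
    unfolding vertex_list_def by (rule someI_ex)
  thus "distinct (vertex_list V)" "set (vertex_list V) = V" "length (vertex_list V) = card V"
    using distinct_card by fastforce+
qed

lemma adjacency_matrix_carrier: "adjacency_matrix V E \<in> carrier_mat (card V) (card V)"
  by (simp add: adjacency_matrix_def)

lemma adjacency_matrix_sym:
  assumes "i < card V" "j < card V"
  shows "adjacency_matrix V E $$ (i, j) = adjacency_matrix V E $$ (j, i)"
  using assms by (simp add: adjacency_matrix_def insert_commute)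

lemma adjacency_matrix_trace:
  assumes "simple_graph V E"
  shows "mat_trace (adjacency_matrix V E) = 0"
proof -
  \<comment> \<open>A diagonal entry tests the set \<open>{v, v} = {v}\<close>, which is too small
    to be an edge.\<close>
  have "{x} \<notin> E" for x using assms by (auto simp: simple_graph_def all_edges_def)
  thus ?thesis by (simp add: mat_trace_def adjacency_matrix_def)
qed

text \<open>Double counting: the ordered pairs are partitioned by the edge they span, and each edge
  has two orderings.\<close>

lemma card_ordered_edges:
  assumes "simple_graph V E"
  shows "card {(u, w). {u, w} \<in> E} = 2 * card E"
proof -
  have fin: "finite E"
    using assms unfolding simple_graph_def all_edges_def
    by (auto intro: finite_subset[of _ "Pow V"])
  have two: "card {(u, w). {u, w} = e} = 2" if "e \<in> E" for e
  proof -
    from that assms have "card e = 2" by (auto simp: simple_graph_def all_edges_def)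
    then obtain a b where "e = {a, b}" "a \<noteq> b" by (auto simp: card_2_iff)
    hence "{(u, w). {u, w} = e} = {(a, b), (b, a)}" by (auto simp: doubleton_eq_iff)
    thus ?thesis using \<open>a \<noteq> b\<close> by simp
  qed
  have "{(u, w). {u, w} \<in> E} = (\<Union>e\<in>E. {(u, w). {u, w} = e})" by auto
  also have "card \<dots> = (\<Sum>e\<in>E. card {(u, w). {u, w} = e})"
    \<comment> \<open>Each fibre is finite because its cardinality 2 is positive.\<close>
    using fin two by (intro card_UN_disjoint) (auto intro!: card_ge_0_finite)
  finally show ?thesis by (simp add: two)
qed

text \<open>The entries are 0 or 1 and symmetric, so the trace of the square counts ordered pairs of
  adjacent vertices.\<close>

lemma adjacency_matrix_square_trace:
  assumes G: "simple_graph V E"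
  shows "mat_trace (adjacency_matrix V E * adjacency_matrix V E) = 2 * real (card E)"
proof -
  have V: "finite V" and EV: "\<Union> E \<subseteq> V"
    using G by (auto simp: simple_graph_def all_edges_def)
  define f where "f = (\<lambda>u w. if {u, w} \<in> E then 1 else 0 :: real)"
  let ?v = "\<lambda>i. vertex_list V ! i"
  note vl = vertex_list[OF V]
  have bij: "bij_betw ?v {..<card V} V"
    using vl by (intro bij_betw_nth) auto
  have "mat_trace (adjacency_matrix V E * adjacency_matrix V E)
    = (\<Sum>i<card V. \<Sum>j<card V. f (?v i) (?v j))"
    unfolding mat_trace_mult[OF adjacency_matrix_carrier adjacency_matrix_carrier]
    by (intro sum.cong) (auto simp: adjacency_matrix_def f_def insert_commute)
  also have "\<dots> = (\<Sum>u\<in>V. \<Sum>w\<in>V. f u w)"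
    by (simp add: sum.reindex_bij_betw[OF bij, of "f _"]
        sum.reindex_bij_betw[OF bij, of "\<lambda>u. \<Sum>w\<in>V. f u w"])
  also have "\<dots> = (\<Sum>p\<in>V \<times> V. if p \<in> {(u, w). {u, w} \<in> E} then 1 else 0)"
    unfolding sum.cartesian_product f_def by (intro sum.cong) auto
  also have "\<dots> = (\<Sum>p\<in>V \<times> V \<inter> {(u, w). {u, w} \<in> E}. 1)"
    using V by (subst sum.inter_restrict) auto
  also have "V \<times> V \<inter> {(u, w). {u, w} \<in> E} = {(u, w). {u, w} \<in> E}"
    using EV by auto
  finally show ?thesis by (simp add: card_ordered_edges[OF G])
qed

section \<open>The energy bound\<close>

text \<open>Here \<open>a\<close> and \<open>b\<close> play \<lambda>_1 and \<lambda>_2,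
  \<open>c\<close> plays \<lambda>_n, and the halved sum of absolute values is half the
  energy.\<close>

lemma sum_squares_le_two_largest:
  fixes a b c :: real
  assumes zero: "a + sum_list (b # xs) = 0"
    and bounds: "\<forall>x\<in>set (b # xs). c \<le> x \<and> x \<le> b" and "b \<le> a"
  shows "a\<^sup>2 + (\<Sum>x\<leftarrow>b # xs. x\<^sup>2)
    \<le> a * (a - b) + (b - c) * ((\<bar>a\<bar> + (\<Sum>x\<leftarrow>b # xs. \<bar>x\<bar>)) / 2)"
proof -
  define ys where "ys = b # xs"
  \<comment> \<open>The two fractions are the positive and negative parts of \<open>x\<close>, which
    merges the cases \<open>x\<^sup>2 \<le> b * x\<close> and \<open>x\<^sup>2 \<le> c * x\<close>
    into one summable bound.\<close>
  have termwise: "x\<^sup>2 \<le> b * ((\<bar>x\<bar> + x) / 2) - c * ((\<bar>x\<bar> - x) / 2)" if "x \<in> set ys" for x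
    using bounds that mult_right_mono[of x b x] mult_right_mono_neg[of c x x]
    by (cases "x \<ge> 0") (auto simp: ys_def power2_eq_square)
  have "(\<Sum>x\<leftarrow>ys. x\<^sup>2) \<le> (\<Sum>x\<leftarrow>ys. b * ((\<bar>x\<bar> + x) / 2) - c * ((\<bar>x\<bar> - x) / 2))"
    by (rule sum_list_mono) (rule termwise)
  also have "\<dots> = b * (((\<Sum>x\<leftarrow>ys. \<bar>x\<bar>) + sum_list ys) / 2) - c * (((\<Sum>x\<leftarrow>ys. \<bar>x\<bar>) - sum_list ys) / 2)"
    by (induction ys) (simp_all add: field_simps)
  finally have *: "(\<Sum>x\<leftarrow>ys. x\<^sup>2) \<le> \<dots>" .
  have s: "sum_list ys = - a" using zero by (simp add: ys_def)
  \<comment> \<open>Otherwise every entry of \<open>ys\<close> would be negative, although they sum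
    to \<open>- a\<close>. The sign is needed to replace \<open>\<bar>a\<bar>\<close> by
    \<open>a\<close>.\<close>
  have "a \<ge> 0"
  proof (rule ccontr)
    assume "\<not> a \<ge> 0"
    hence "sum_list ys \<le> sum_list (map (\<lambda>_. 0) ys)"
      using bounds \<open>b \<le> a\<close> sum_list_mono[of ys "\<lambda>x. x" "\<lambda>_. 0"] by (fastforce simp: ys_def)
    thus False using s \<open>\<not> a \<ge> 0\<close> by simp
  qed
  \<comment> \<open>With S the half sum on the right, the positive parts over \<open>ys\<close> add
    up to S - \<open>a\<close> and the negative parts to S.\<close>
  thus ?thesis using * unfolding s ys_def[symmetric]
    by (simp add: field_simps power2_eq_square)
qed

theorem energy_bound:
  assumes G: "simple_graph V E" and n: "card V = n" "n \<ge> 2"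
  shows "2 * real (card E) - graph_eigenvalue V E 1 * (graph_eigenvalue V E 1 - graph_eigenvalue V E 2)
    \<le> (graph_eigenvalue V E 2 - graph_eigenvalue V E n) * (graph_energy V E / 2)"
    and "graph_eigenvalue V E n \<le> graph_eigenvalue V E 2"
proof -
  note sp = symmetric_spectrum[OF adjacency_matrix_carrier adjacency_matrix_sym,
      of V E, folded graph_spectrum_def]
  define ls where "ls = rev (sorted_list_of_multiset (graph_spectrum V E))"
  have ms: "graph_spectrum V E = mset ls" by (simp add: ls_def)
  have ev: "graph_eigenvalue V E i = ls ! (i - 1)" for i
    by (simp add: graph_eigenvalue_def ls_def)
  have len: "length ls = n" using sp(1) n by (simp add: ms)
  have "sorted_wrt (\<ge>) ls" unfolding ls_def sorted_wrt_rev
    using sorted_sorted_list_of_multiset by simp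
  moreover obtain a b xs where ls: "ls = a # b # xs"
    using len n by (metis Suc_le_length_iff numeral_2_eq_2)
  ultimately have ba: "b \<le> a" and up: "\<forall>x\<in>set (b # xs). x \<le> b"
    and sorted: "sorted_wrt (\<ge>) (b # xs)" by auto
  \<comment> \<open>Taking the last entry of \<open>b # xs\<close> also covers \<open>n = 2\<close>,
    where \<open>xs\<close> is empty and \<open>c = b\<close>.\<close>
  define c where "c = last (b # xs)"
  have "\<forall>x\<in>set ys. last ys \<le> x" if "sorted_wrt (\<ge>) ys" for ys :: "real list"
    using that by (induction ys) auto
  from this[OF sorted] have low: "\<forall>x\<in>set (b # xs). c \<le> x" by (simp add: c_def)
  have lam: "graph_eigenvalue V E 1 = a" "graph_eigenvalue V E 2 = b"
    by (simp_all add: ev ls)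
  have lamn: "graph_eigenvalue V E n = c"
    using last_conv_nth[of ls] by (simp add: ev ls c_def flip: len)
  have zero: "a + sum_list (b # xs) = 0"
    using sp(2) adjacency_matrix_trace[OF G] by (simp add: ms ls sum_mset_sum_list)
  have squares: "a\<^sup>2 + (\<Sum>x\<leftarrow>b # xs. x\<^sup>2) = 2 * real (card E)"
    using sp(3) adjacency_matrix_square_trace[OF G]
    by (simp add: ms ls sum_mset_sum_list flip: mset_map)
  have energy: "graph_energy V E = \<bar>a\<bar> + (\<Sum>x\<leftarrow>b # xs. \<bar>x\<bar>)"
    by (simp add: graph_energy_def ms ls sum_mset_sum_list flip: mset_map)
  have "\<forall>x\<in>set (b # xs). c \<le> x \<and> x \<le> b" using up low by blast
  from sum_squares_le_two_largest[OF zero this ba]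
  show "2 * real (card E) - graph_eigenvalue V E 1 * (graph_eigenvalue V E 1 - graph_eigenvalue V E 2)
    \<le> (graph_eigenvalue V E 2 - graph_eigenvalue V E n) * (graph_energy V E / 2)"
    unfolding squares lam lamn energy by linarith
  show "graph_eigenvalue V E n \<le> graph_eigenvalue V E 2"
    using low by (simp add: lam lamn)
qed

theorem theorem1p5:
  fixes V :: "'a set" and E :: "'a set set" and n m :: nat and lam :: "nat \<Rightarrow> real"
  assumes "regular_graph V E"
    and "card V = n" and "card E = m"
    and "\<not> is_complete_graph V E" and "\<not> is_empty_graph E"
    and "\<And>i. i \<in> {1..n} \<Longrightarrow> lam i = graph_eigenvalue V E i"
  shows "1 / 2 * graph_energy V E
           \<ge> (2 * real m - lam 1 * (lam 1 - lam 2)) / (lam 2 - lam n)"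
proof -
  have G: "simple_graph V E" using assms(1) by (simp add: regular_graph_def)
  \<comment> \<open>An edge supplies two vertices, so the indices 1, 2 and \<open>n\<close> all lie
    in the range where \<open>lam\<close> is specified.\<close>
  obtain e where "e \<in> E" using assms(5) by (auto simp: is_empty_graph_def)
  hence "e \<subseteq> V" "card e = 2" "finite V"
    using G by (auto simp: simple_graph_def all_edges_def)
  hence n: "n \<ge> 2" using card_mono[of V e] assms(2) by simp
  have lam: "lam 1 = graph_eigenvalue V E 1" "lam 2 = graph_eigenvalue V E 2"
    "lam n = graph_eigenvalue V E n" using assms(6) n by auto
  note bound = energy_bound[OF G assms(2) n, folded lam, unfolded assms(3)]
  show ?thesis
  proof (cases "lam 2 = lam n")
    \<comment> \<open>Division by zero yields 0, so the claim reduces to nonnegativity of the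
      energy.\<close>
    case True
    have "(\<Sum>x\<in>#M. \<bar>x\<bar>) \<ge> 0" for M :: "real multiset" by (induction M) auto
    hence "graph_energy V E \<ge> 0" by (simp only: graph_energy_def)
    thus ?thesis using True by simp
  next
    case False
    \<comment> \<open>The second part of \<open>bound\<close> and \<open>False\<close> make the
      denominator positive, so the product form can be divided by it.\<close>
    thus ?thesis using bound by (simp add: divide_le_eq mult.commute)
  qed
qed

end
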